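(* Let $n$ and $k$ be positive integers satisfying $n\geq 8(2k+2)^2$. Then $$2k+1 \le tw(G_{n,k}) \le pw(G_{n,k}) \le 2k+2.$$
   Context: For positive integers $k<n/2$, the generalized Petersen graph $G_{n,k}$ is the simple graph with vertex set $\{v_1,\dots,v_n,u_1,\dots,u_n\}$ and edge set $\{v_iu_i\}\cup\{v_iv_{i+1}\}\cup\{u_iu_{i+k}\}$, $i=1,\dots,n$, with subscripts read modulo $n$. $tw$ and $pw$ denote treewidth and pathwidth. *)

theory Defs
  imports "Graph_Theory.Graph_Theory"
begin

text \<open>
  As in \<^theory>\<open>Graph_Theory.Kuratowski\<close>, a finite simple undirected graph is a
  \<^locale>\<open>pair_graph\<close>: a finite, loop-free digraph whose arc set is a symmetric relation.
\<close>


section \<open>Trees and paths\<close>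

text \<open>
  The predicate \<^const>\<open>tree\<close> of the library is not suitable for undirected graphs: in a
  symmetric digraph, going along an edge and back is a \<^const>\<open>pre_digraph.cycle\<close> of
  length 2.  The cycles of a simple graph are exactly those of length at least 3.
\<close>

definition undirected_tree :: "'t pair_pre_digraph \<Rightarrow> bool" where
  "undirected_tree T \<longleftrightarrow>
     pair_graph T \<and> connected (with_proj T) \<and>
     \<not> (\<exists>p. pre_digraph.cycle (with_proj T) p \<and> length p \<ge> 3)"

definition undirected_path :: "'t pair_pre_digraph \<Rightarrow> bool" where
  "undirected_path T \<longleftrightarrow>
     (\<exists>xs. xs \<noteq> [] \<and> distinct xs \<and> pverts T = set xs \<and>
        parcs T = {(xs ! i, xs ! Suc i) | i. Suc i < length xs} \<union>
                  {(xs ! Suc i, xs ! i) | i. Suc i < length xs})"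


section \<open>Treewidth and pathwidth\<close>

text \<open>
  \<^const>\<open>connected\<close> includes non-emptiness, so the last clause says that the nodes whose bag
  contains \<open>v\<close> induce a non-empty subtree.
\<close>

definition tree_decomposition ::
    "'a pair_pre_digraph \<Rightarrow> 't pair_pre_digraph \<Rightarrow> ('t \<Rightarrow> 'a set) \<Rightarrow> bool" where
  "tree_decomposition G T B \<longleftrightarrow>
     undirected_tree T \<and>
     (\<Union>t\<in>pverts T. B t) = pverts G \<and>
     (\<forall>(x, y)\<in>parcs G. \<exists>t\<in>pverts T. x \<in> B t \<and> y \<in> B t) \<and>
     (\<forall>v\<in>pverts G. connected (with_proj T \<restriction> {t \<in> pverts T. v \<in> B t}))"

definition path_decomposition ::
    "'a pair_pre_digraph \<Rightarrow> 't pair_pre_digraph \<Rightarrow> ('t \<Rightarrow> 'a set) \<Rightarrow> bool" where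
  "path_decomposition G T B \<longleftrightarrow> tree_decomposition G T B \<and> undirected_path T"

text \<open>
  The subtraction truncates only if all bags are empty, that is, for the graph without vertices.
\<close>

definition decomposition_width :: "'t pair_pre_digraph \<Rightarrow> ('t \<Rightarrow> 'a set) \<Rightarrow> nat" where
  "decomposition_width T B = Max ((\<lambda>t. card (B t)) ` pverts T) - 1"

text \<open>
  Since the trees are finite, it is no restriction to take their nodes to be natural numbers.
\<close>

definition treewidth :: "'a pair_pre_digraph \<Rightarrow> nat" where
  "treewidth G =
     (LEAST w. \<exists>(T :: nat pair_pre_digraph) B.
        tree_decomposition G T B \<and> decomposition_width T B = w)"

definition pathwidth :: "'a pair_pre_digraph \<Rightarrow> nat" where
  "pathwidth G =
     (LEAST w. \<exists>(T :: nat pair_pre_digraph) B.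
        path_decomposition G T B \<and> decomposition_width T B = w)"


text \<open>Both minima above range over non-empty sets:\<close>

lemma path_decomposition_trivial:
  assumes "pair_graph G"
  shows "path_decomposition G \<lparr>pverts = {0::nat}, parcs = {}\<rparr> (\<lambda>_. pverts G)"
proof -
  let ?T = "\<lparr>pverts = {0::nat}, parcs = {}\<rparr>"
  interpret G: pair_graph G by fact
  have T: "pair_graph ?T"
    by unfold_locales (auto simp: symmetric_def)
  have c: "connected (with_proj ?T)"
    by (auto simp: connected_def strongly_connected_def reachable_def mk_symmetric_def intro: rtrancl_on.intros)
  have nc: "\<not> pre_digraph.cycle (with_proj ?T) p" for p
    by (cases p) (auto simp: pre_digraph.cycle_def pre_digraph.awalk_def)
  have r: "with_proj ?T \<restriction> {0} = with_proj ?T"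
    by (auto simp: induce_subgraph_def with_proj_def)
  have r': "connected (with_proj ?T \<restriction> {0})"
    unfolding r by (rule c)
  have p: "undirected_path ?T"
    unfolding undirected_path_def by (rule exI[of _ "[0]"]) auto
  show ?thesis
    unfolding path_decomposition_def tree_decomposition_def undirected_tree_def
    using T c nc p r' by (auto simp: G.in_arcsD1 G.in_arcsD2)
qed


section \<open>Generalized Petersen graphs\<close>

text \<open>
  \<open>Outer i\<close> is $v_i$ and \<open>Inner i\<close> is $u_i$.  The subscripts are represented by the
  residues $0, \dots, n-1$ modulo $n$, so that the subscript $n$ becomes $0$.
\<close>

datatype petersen_vertex = Outer nat | Inner nat

definition generalized_petersen :: "nat \<Rightarrow> nat \<Rightarrow> petersen_vertex pair_pre_digraph" where
  "generalized_petersen n k =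
     (let E = {(Outer i, Inner i) | i. i < n} \<union>
              {(Outer i, Outer ((i + 1) mod n)) | i. i < n} \<union>
              {(Inner i, Inner ((i + k) mod n)) | i. i < n}
      in \<lparr> pverts = Outer ` {..<n} \<union> Inner ` {..<n}, parcs = E \<union> E\<inverse> \<rparr>)"

lemma mod_add_neq:
  fixes i k n :: nat
  assumes "i < n" "0 < k" "k < n"
  shows "(i + k) mod n \<noteq> i"
  using assms by (cases "i + k < n") (auto simp: mod_if)

lemma pair_graph_generalized_petersen:
  assumes "0 < k" "2 * k < n"
  shows "pair_graph (generalized_petersen n k)"
proof -
  let ?G = "generalized_petersen n k"
  have "0 < n" using assms by simp
  have 1: "parcs ?G \<subseteq> pverts ?G \<times> pverts ?G"
    using \<open>0 < n\<close> by (auto simp: generalized_petersen_def Let_def)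
  have 2: "finite (pverts ?G)"
    by (simp add: generalized_petersen_def Let_def)
  have 3: "finite (parcs ?G)"
    using 1 2 by (meson finite_SigmaI finite_subset)
  have 4: "fst e \<noteq> snd e" if "e \<in> parcs ?G" for e
    using that assms mod_add_neq[of _ n k] mod_add_neq[of _ n 1]
    by (auto simp: generalized_petersen_def Let_def) metis+
  have 5: "sym (parcs ?G)"
    by (auto simp: generalized_petersen_def Let_def sym_def)
  show ?thesis
    by unfold_locales (use 1 2 3 4 5 in \<open>auto simp: symmetric_def\<close>)
qed

end

theory Submission
  imports Defs
begin

text \<open>
  For the lower bound, suppose that all bags have at most \<open>2 * k + 1\<close> vertices.  For a bag \<open>X\<close>, consider
  the outer vertices \<open>Outer i\<close> such that the \<open>k\<close> columns starting at \<open>i\<close> avoid \<open>X\<close>.  As \<open>X\<close>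
  spoils at most \<open>k * (2 * k + 1) < n / 2\<close> indices, any two bags have such a vertex in common.  Two of them
  are connected outside \<open>X\<close>, because separating two windows needs \<open>k + 1\<close> vertices on each
  of the two arcs between them.  Hence every node of the tree points to the neighbour on whose side these
  vertices live, and as the tree has no cycle some two adjacent nodes point to each other.  A
  vertex common to both would live on both sides of their edge, which is a bridge.

  For the upper bound, a window slides once around the columns.
\<close>

section \<open>Trees\<close>

lemma connected_induce_iff:
  assumes "sym (parcs T)"
  shows "connected (with_proj T \<restriction> A) \<longleftrightarrow>
    A \<noteq> {} \<and> (\<forall>u\<in>A. \<forall>v\<in>A. (u, v) \<in> (Restr (parcs T) A)\<^sup>*)"
proof -
  let ?R = "Restr (parcs T) A"
  have "arcs_ends (with_proj T \<restriction> A) = ?R"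
    by (auto simp: arcs_ends_def arc_to_ends_def induce_subgraph_def with_proj_def)
  moreover have "?R\<^sup>s = ?R"
    using assms by (auto simp: symcl_def sym_def)
  moreover have "(u, v) \<in> rtrancl_on A ?R \<longleftrightarrow> (u, v) \<in> ?R\<^sup>*" if "u \<in> A" "v \<in> A" for u v
    using that rtrancl_consistent_rtrancl_on[of u v ?R A] rtrancl_on_rtranclI[of u v A ?R] by auto
  ultimately show ?thesis
    by (auto simp: connected_conv)
qed

lemma connected_with_proj_iff:
  assumes "pair_graph T"
  shows "connected (with_proj T) \<longleftrightarrow>
    pverts T \<noteq> {} \<and> (\<forall>u\<in>pverts T. \<forall>v\<in>pverts T. (u, v) \<in> (parcs T)\<^sup>*)"
proof -
  interpret pair_graph T by fact
  have sub: "parcs T \<subseteq> pverts T \<times> pverts T"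
    using in_arcsD1 in_arcsD2 by fastforce
  have s: "sym (parcs T)"
    using sym_arcs by (simp add: symmetric_def)
  have "with_proj T \<restriction> pverts T = with_proj T"
    using sub by (auto simp: induce_subgraph_def with_proj_def)
  moreover have "Restr (parcs T) (pverts T) = parcs T"
    using sub by auto
  ultimately show ?thesis
    using connected_induce_iff[OF s, of "pverts T"] by simp
qed

text \<open>The arcs of \<open>with_proj T\<close> are the pairs themselves, so a non-empty vertex
  list determines its walk: the list zipped with its tail. Together with the converse below this
  replaces arc walks by vertex lists.\<close>

lemma walk_of_vertices:
  assumes "ys \<noteq> []" "successively (\<lambda>x y. (x, y) \<in> parcs T) ys"
  shows "set (zip ys (tl ys)) \<subseteq> parcs T \<and> pre_digraph.cas (with_proj T) (hd ys) (zip ys (tl ys)) (last ys) \<and>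
    pre_digraph.awalk_verts (with_proj T) (hd ys) (zip ys (tl ys)) = ys"
  using assms
proof (induction ys)
  case (Cons x ys)
  then show ?case
    by (cases ys) (auto simp: pre_digraph.cas.simps pre_digraph.awalk_verts.simps)
qed simp

lemma vertices_of_walk:
  assumes "set p \<subseteq> parcs T" "pre_digraph.cas (with_proj T) u p v"
  shows "successively (\<lambda>x y. (x, y) \<in> parcs T) (pre_digraph.awalk_verts (with_proj T) u p) \<and>
    pre_digraph.awalk_verts (with_proj T) u p \<noteq> [] \<and>
    hd (pre_digraph.awalk_verts (with_proj T) u p) = u \<and>
    last (pre_digraph.awalk_verts (with_proj T) u p) = v \<and>
    length (pre_digraph.awalk_verts (with_proj T) u p) = Suc (length p)"
  using assms
proof (induction p arbitrary: u)
  case (Cons e p)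
  then show ?case
    by (fastforce simp: pre_digraph.cas.simps pre_digraph.awalk_verts.simps successively_Cons)
qed (simp add: pre_digraph.cas.simps pre_digraph.awalk_verts.simps)

text \<open>A closed walk lists its start again at the end, so three arcs become four listed
  vertices and only the tail can be distinct.\<close>

lemma ex_cycle_iff:
  assumes "pair_graph T"
  shows "(\<exists>p. pre_digraph.cycle (with_proj T) p \<and> length p \<ge> 3) \<longleftrightarrow>
    (\<exists>ys. length ys \<ge> 4 \<and> hd ys = last ys \<and> distinct (tl ys) \<and>
       successively (\<lambda>x y. (x, y) \<in> parcs T) ys)" (is "?L \<longleftrightarrow> ?R")
proof
  assume ?L
  then obtain p u where "set p \<subseteq> parcs T" "pre_digraph.cas (with_proj T) u p u"
    "distinct (tl (pre_digraph.awalk_verts (with_proj T) u p))" "length p \<ge> 3"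
    by (auto simp: pre_digraph.cycle_def pre_digraph.awalk_def)
  with vertices_of_walk[of p T u u] show ?R
    by (intro exI[of _ "pre_digraph.awalk_verts (with_proj T) u p"]) auto
next
  interpret pair_graph T by fact
  assume ?R
  then obtain ys where ys: "length ys \<ge> 4" "hd ys = last ys" "distinct (tl ys)"
    "successively (\<lambda>x y. (x, y) \<in> parcs T) ys" by blast
  then have "ys \<noteq> []" by auto
  note w = walk_of_vertices[OF this ys(4)]
  obtain x y zs where "ys = x # y # zs"
    using ys(1) by (cases ys; cases "tl ys") auto
  then have "hd ys \<in> pverts T"
    using ys(4) in_arcsD1 by auto
  with w ys have "pre_digraph.cycle (with_proj T) (zip ys (tl ys))"
    unfolding pre_digraph.cycle_def pre_digraph.awalk_def
    by (intro exI[of _ "hd ys"]) (cases ys; cases "tl ys"; auto)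
  then show ?L
    using ys(1) by (intro exI[of _ "zip ys (tl ys)"]) auto
qed

section \<open>Simple paths, bridges, and an obstruction to small bags\<close>

lemma rtrancl_distinct_path:
  assumes "(x, y) \<in> R\<^sup>*"
  shows "\<exists>ps. ps \<noteq> [] \<and> distinct ps \<and> hd ps = x \<and> last ps = y \<and> successively (\<lambda>a b. (a, b) \<in> R) ps"
  using assms
proof (induction rule: converse_rtrancl_induct)
  case base
  show ?case by (intro exI[of _ "[y]"]) simp
next
  case (step x z)
  then obtain ps where ps: "ps \<noteq> []" "distinct ps" "hd ps = z" "last ps = y"
    "successively (\<lambda>a b. (a, b) \<in> R) ps" by blast
  show ?case
  proof (cases "x \<in> set ps")
    case True
    then obtain as bs where "ps = as @ x # bs"
      by (meson split_list)
    \<comment> \<open>Cutting off what precedes the earlier visit to \<open>x\<close> leaves a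
      simple path that already starts at \<open>x\<close>.\<close>
    with ps show ?thesis
      by (intro exI[of _ "x # bs"]) (auto simp: successively_append_iff)
  next
    case False
    with ps step(1) show ?thesis
      by (intro exI[of _ "x # ps"]) (auto simp: successively_Cons)
  qed
qed

text \<open>\<open>s\<close> is the vertex after the last visit to \<open>t\<close>; what follows
  never returns to \<open>t\<close>.\<close>

lemma rtrancl_first_step:
  assumes "(t, r) \<in> E\<^sup>*" "E \<subseteq> V \<times> V" "r \<noteq> t"
  shows "\<exists>s. (t, s) \<in> E \<and> (s, r) \<in> (Restr E (V - {t}))\<^sup>*"
  using assms(1,3)
proof (induction rule: rtrancl_induct)
  case (step y z)
  show ?case
  proof (cases "y = t")
    case False
    with step.IH obtain s where "(t, s) \<in> E" "(s, y) \<in> (Restr E (V - {t}))\<^sup>*" by blast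
    moreover have "(y, z) \<in> Restr E (V - {t})"
      using step.hyps(2) step.prems assms(2) False by auto
    ultimately show ?thesis by (meson rtrancl.rtrancl_into_rtrancl)
  qed (use step in blast)
qed simp

lemma sym_rtrancl_Restr: "sym E \<Longrightarrow> sym ((Restr E A)\<^sup>*)"
  by (intro sym_rtrancl) (auto simp: sym_def)

text \<open>Following \<open>f\<close> must revisit a node, as the tree is finite. The shortest
  period is not 1 because there are no loops, and not 2 if nothing backtracks; a shortest period of
  at least 3 traces a cycle.\<close>

lemma undirected_tree_backtrack:
  assumes T: "undirected_tree T" and f: "\<And>t. t \<in> pverts T \<Longrightarrow> (t, f t) \<in> parcs T"
  shows "\<exists>t\<in>pverts T. f (f t) = t"
proof (rule ccontr)
  assume nb: "\<not> ?thesis"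
  have pg: "pair_graph T"
    using T by (simp add: undirected_tree_def)
  interpret pair_graph T by fact
  obtain t0 where t0: "t0 \<in> pverts T"
    using T connected_with_proj_iff[OF pg] by (auto simp: undirected_tree_def)
  define c where "c i = (f ^^ i) t0" for i
  have c_Suc: "c (Suc i) = f (c i)" for i
    by (simp add: c_def)
  have cV: "c i \<in> pverts T" for i
  proof (induction i)
    case (Suc i)
    with f[of "c i"] show ?case
      using in_arcsD2 by (auto simp: c_Suc)
  qed (simp add: c_def t0)
  have "\<not> inj c"
    using finite_verts cV finite_imageD[of c UNIV] finite_subset[of "range c" "pverts T"] by auto
  then obtain x y where "c x = c y" "x < y"
    unfolding inj_def by (metis linorder_neqE_nat)
  \<comment> \<open>\<open>P d\<close> allows any starting position, so the least \<open>d\<close>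
    excludes shorter repetitions everywhere along the sequence. This makes the closed segment
    simple.\<close>
  define P where "P d \<longleftrightarrow> d > 0 \<and> (\<exists>i. c i = c (i + d))" for d
  define d where "d = (LEAST d. P d)"
  have "P (y - x)"
    using \<open>c x = c y\<close> \<open>x < y\<close> by (auto simp: P_def intro!: exI[of _ x])
  then have d: "P d"
    unfolding d_def by (rule LeastI)
  have min: "c i \<noteq> c (i + e)" if "e < d" "e > 0" for e i
    using that not_less_Least[of e P] by (auto simp: P_def d_def)
  obtain i where i: "d > 0" "c (i + d) = c i"
    using d unfolding P_def by metis
  have "c i \<noteq> c (Suc i)"
    using f[OF cV[of i]] no_loops[of "(c i, f (c i))"] by (auto simp: c_Suc)
  moreover have "c i \<noteq> c (Suc (Suc i))"
    using nb cV[of i] by (metis c_Suc)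
  ultimately have "d \<noteq> 1" "d \<noteq> 2"
    using i by (auto simp: numeral_2_eq_2)
  then have d3: "d \<ge> 3"
    using i by linarith
  let ?ys = "map c [i..<Suc (i + d)]"
  have inj: "inj_on c {Suc i..<Suc (i + d)}"
  proof (rule linorder_inj_onI)
    fix a b assume "a < b" "a \<in> {Suc i..<Suc (i + d)}" "b \<in> {Suc i..<Suc (i + d)}"
    then show "c a \<noteq> c b"
      using min[of "b - a" a] by auto
  qed auto
  have "successively (\<lambda>x y. (x, y) \<in> parcs T) ?ys"
    using f[OF cV] by (simp add: successively_conv_nth c_Suc del: upt_Suc)
  moreover have "distinct (tl ?ys)"
    using inj by (simp add: distinct_map map_tl[symmetric] tl_upt del: upt_Suc)
  moreover have "hd ?ys = last ?ys"
    using i by (simp add: hd_map last_map del: upt_Suc)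
  moreover have "length ?ys \<ge> 4"
    using d3 by simp
  ultimately show False
    using T ex_cycle_iff[OF pg] unfolding undirected_tree_def by blast
qed

text \<open>A simple path from \<open>s\<close> to \<open>t\<close> that avoids the edge has an
  intermediate vertex, and prefixing \<open>t\<close> closes it to a cycle.\<close>

lemma undirected_tree_bridge:
  assumes T: "undirected_tree T" and st: "(s, t) \<in> parcs T"
  shows "(s, t) \<notin> (parcs T - {(s, t), (t, s)})\<^sup>*"
proof
  have pg: "pair_graph T"
    using T by (simp add: undirected_tree_def)
  interpret pair_graph T by fact
  assume "(s, t) \<in> (parcs T - {(s, t), (t, s)})\<^sup>*"
  then obtain ps where ps: "ps \<noteq> []" "distinct ps" "hd ps = s" "last ps = t"
    "successively (\<lambda>a b. (a, b) \<in> parcs T - {(s, t), (t, s)}) ps"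
    using rtrancl_distinct_path by metis
  have "s \<noteq> t"
    using st no_loops[of "(s, t)"] by auto
  with ps have "length ps \<ge> 3"
    by (cases ps; cases "tl ps"; cases "tl (tl ps)") auto
  moreover have "successively (\<lambda>a b. (a, b) \<in> parcs T) ps"
    using ps(5) by (rule successively_mono) auto
  moreover have "(t, s) \<in> parcs T"
    using st sym_arcs by (simp add: symmetric_def) (erule symD)
  ultimately have "\<exists>ys. length ys \<ge> 4 \<and> hd ys = last ys \<and> distinct (tl ys) \<and>
       successively (\<lambda>x y. (x, y) \<in> parcs T) ys"
    using ps by (intro exI[of _ "t # ps"]) (auto simp: successively_Cons)
  then show False
    using T ex_cycle_iff[OF pg] unfolding undirected_tree_def by blast
qed

text \<open>\<open>S\<close> acts like a haven: all bags meeting \<open>S t\<close> lie in one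
  component of the tree without \<open>t\<close>, which singles out a neighbour of \<open>t\<close>.
  Two adjacent nodes that single out each other, with a vertex common to their sets, contradict the
  edge between them being a bridge.\<close>

lemma tree_decomposition_no_haven:
  assumes dec: "tree_decomposition G T B"
    and sub: "\<And>t. t \<in> pverts T \<Longrightarrow> S t \<subseteq> pverts G - B t"
    and conn: "\<And>t u v. t \<in> pverts T \<Longrightarrow> u \<in> S t \<Longrightarrow> v \<in> S t \<Longrightarrow>
      (u, v) \<in> (Restr (parcs G) (pverts G - B t))\<^sup>*"
    and inter: "\<And>s t. s \<in> pverts T \<Longrightarrow> t \<in> pverts T \<Longrightarrow> S s \<inter> S t \<noteq> {}"
  shows False
proof -
  let ?E = "parcs T" and ?V = "pverts T"
  let ?R = "\<lambda>t. Restr ?E (?V - {t})"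
  have tree: "undirected_tree T"
    and cover: "(\<Union>t\<in>?V. B t) = pverts G"
    and edge: "\<And>x y. (x, y) \<in> parcs G \<Longrightarrow> \<exists>t\<in>?V. x \<in> B t \<and> y \<in> B t"
    and subtree: "\<And>v. v \<in> pverts G \<Longrightarrow> connected (with_proj T \<restriction> {t \<in> ?V. v \<in> B t})"
    using dec by (auto simp: tree_decomposition_def)
  have pg: "pair_graph T"
    using tree by (simp add: undirected_tree_def)
  interpret T: pair_graph T by fact
  have E: "?E \<subseteq> ?V \<times> ?V" and symE: "sym ?E"
    using T.in_arcsD1 T.in_arcsD2 T.sym_arcs by (fastforce simp: symmetric_def)+
  \<comment> \<open>The nodes whose bags contain \<open>v\<close> form a subtree, and
    \<open>t\<close> is not among them.\<close>
  have same: "(r, r') \<in> (?R t)\<^sup>*"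
    if "v \<in> pverts G - B t" "r \<in> ?V" "r' \<in> ?V" "v \<in> B r" "v \<in> B r'" for v t r r'
  proof -
    have "(r, r') \<in> (Restr ?E {t \<in> ?V. v \<in> B t})\<^sup>*"
      using subtree[of v] that unfolding connected_induce_iff[OF symE] by blast
    moreover have "Restr ?E {t \<in> ?V. v \<in> B t} \<subseteq> ?R t"
      using that by auto
    ultimately show ?thesis
      using rtrancl_mono by blast
  qed
  \<comment> \<open>Consecutive vertices of a walk share a bag \<open>q\<close>, where their
    subtrees meet. The walk thus lifts to a walk in the tree that avoids \<open>t\<close>.\<close>
  have bags: "(r, r') \<in> (?R t)\<^sup>*"
    if "(u, v) \<in> (Restr (parcs G) (pverts G - B t))\<^sup>*" "u \<in> pverts G - B t"
      "r \<in> ?V" "u \<in> B r" "r' \<in> ?V" "v \<in> B r'" for t u v r r'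
    using that(1,5,6)
  proof (induction arbitrary: r' rule: rtrancl_induct)
    case base
    then show ?case using same that by blast
  next
    case (step y z)
    then obtain q where "q \<in> ?V" "y \<in> B q" "z \<in> B q"
      using edge by blast
    with step show ?case
      using same[of z t q r'] by (metis IntD2 SigmaD2 rtrancl_trans)
  qed
  \<comment> \<open>All bags meeting \<open>S t\<close> are reached through the same neighbour
    \<open>s\<close>, the first step from \<open>t\<close> towards one of them.\<close>
  have "\<exists>s. (t, s) \<in> ?E \<and> (\<forall>v\<in>S t. \<forall>r\<in>?V. v \<in> B r \<longrightarrow> (s, r) \<in> (?R t)\<^sup>*)"
    if t: "t \<in> ?V" for t
  proof -
    obtain v where v: "v \<in> S t"
      using inter[OF t t] by blast
    then obtain r where r: "r \<in> ?V" "v \<in> B r"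
      using sub[OF t] cover by blast
    with v sub[OF t] have "r \<noteq> t" by blast
    moreover have "(t, r) \<in> ?E\<^sup>*"
      using tree t r connected_with_proj_iff[OF pg] by (auto simp: undirected_tree_def)
    ultimately obtain s where s: "(t, s) \<in> ?E" "(s, r) \<in> (?R t)\<^sup>*"
      using rtrancl_first_step[OF _ E] by blast
    have "(s, r') \<in> (?R t)\<^sup>*" if "w \<in> S t" "r' \<in> ?V" "w \<in> B r'" for w r'
      using s(2) bags[OF conn[OF t v \<open>w \<in> S t\<close>], of r r'] v sub[OF t] r that
      by (meson rtrancl_trans subsetD)
    with s(1) show ?thesis by blast
  qed
  then obtain f where f: "\<And>t. t \<in> ?V \<Longrightarrow> (t, f t) \<in> ?E"
    and f': "\<And>t v r. \<lbrakk>t \<in> ?V; v \<in> S t; r \<in> ?V; v \<in> B r\<rbrakk> \<Longrightarrow> (f t, r) \<in> (?R t)\<^sup>*"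
    by metis
  obtain t where t: "t \<in> ?V" "f (f t) = t"
    using undirected_tree_backtrack[OF tree f] by blast
  define s where "s = f t"
  have s: "s \<in> ?V" "f s = t" "(s, t) \<in> ?E"
    using t E f[OF t(1)] symD[OF symE f[OF t(1)]] by (auto simp: s_def)
  obtain v where v: "v \<in> S s" "v \<in> S t"
    using inter[OF s(1) t(1)] by blast
  then obtain r where r: "r \<in> ?V" "v \<in> B r"
    using sub[OF t(1)] cover by blast
  let ?D = "?E - {(s, t), (t, s)}"
  have "(s, r) \<in> (?R t)\<^sup>*" "(t, r) \<in> (?R s)\<^sup>*"
    using f'[OF t(1) v(2) r] f'[OF s(1) v(1) r] s(2) by (auto simp: s_def)
  then have "(s, r) \<in> (?R t)\<^sup>*" "(r, t) \<in> (?R s)\<^sup>*"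
    using symD[OF sym_rtrancl_Restr[OF symE]] by blast+
  \<comment> \<open>A walk that avoids an end of the edge cannot use the edge, so the two walks
    joined at \<open>r\<close> bypass the bridge.\<close>
  moreover have "?R t \<subseteq> ?D" "?R s \<subseteq> ?D"
    by auto
  ultimately have "(s, t) \<in> ?D\<^sup>*"
    by (meson rtrancl_mono rtrancl_trans subsetD)
  then show False
    using undirected_tree_bridge[OF tree s(3)] by blast
qed

section \<open>The lower bound\<close>

lemma parcs_generalized_petersen:
  assumes "0 < n"
  shows "(Outer (m mod n), Outer (Suc m mod n)) \<in> parcs (generalized_petersen n k)"
    "(Outer (m mod n), Inner (m mod n)) \<in> parcs (generalized_petersen n k)"
    "(Inner (m mod n), Inner ((m + k) mod n)) \<in> parcs (generalized_petersen n k)"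
proof -
  have "m mod n < n" using assms by simp
  moreover have "Suc m mod n = (m mod n + 1) mod n" "(m + k) mod n = (m mod n + k) mod n"
    by (simp_all add: mod_simps)
  ultimately show
    "(Outer (m mod n), Outer (Suc m mod n)) \<in> parcs (generalized_petersen n k)"
    "(Outer (m mod n), Inner (m mod n)) \<in> parcs (generalized_petersen n k)"
    "(Inner (m mod n), Inner ((m + k) mod n)) \<in> parcs (generalized_petersen n k)"
    unfolding generalized_petersen_def Let_def by auto
qed

lemma pverts_generalized_petersen:
  "pverts (generalized_petersen n k) = Outer ` {..<n} \<union> Inner ` {..<n}"
  by (simp add: generalized_petersen_def Let_def)

lemma sym_parcs_generalized_petersen: "sym (parcs (generalized_petersen n k))"
  by (auto simp: generalized_petersen_def Let_def sym_def)

text \<open>The length is \<open>k\<close> because \<open>k\<close> consecutive positions, before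
  reduction modulo \<open>n\<close>, meet every residue class modulo \<open>k\<close>: an inner walk
  in steps of \<open>k\<close> cannot jump over a window.\<close>

definition free_window :: "nat \<Rightarrow> nat \<Rightarrow> petersen_vertex set \<Rightarrow> nat \<Rightarrow> bool" where
  "free_window n k X a \<longleftrightarrow> (\<forall>d<k. Outer ((a + d) mod n) \<notin> X \<and> Inner ((a + d) mod n) \<notin> X)"

lemma free_windowD:
  assumes "free_window n k X a" "a \<le> m" "m < a + k"
  shows "Outer (m mod n) \<notin> X" "Inner (m mod n) \<notin> X"
  using assms by (auto simp: free_window_def dest!: spec[of _ "m - a"])

text \<open>The indices in \<open>M\<close> need not be reduced, so an arc of columns passing from
  \<open>n - 1\<close> to \<open>0\<close> is still an ordinary interval.\<close>

definition columns :: "nat \<Rightarrow> nat set \<Rightarrow> petersen_vertex set" where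
  "columns n M = (\<lambda>m. Outer (m mod n)) ` M \<union> (\<lambda>m. Inner (m mod n)) ` M"

text \<open>
  Between the two windows there are \<open>k + 1\<close> disjoint paths: the outer one, and one inner path for
  each residue class modulo \<open>k\<close>.  If \<open>X\<close> separates the windows, it meets all of them.
\<close>

lemma card_blockers:
  assumes "0 < k" "finite X" "a \<le> b" "b \<le> a + n" "0 < n"
    and wa: "free_window n k X a" and wb: "free_window n k X b"
    and sep: "(Outer (a mod n), Outer (b mod n)) \<notin>
      (Restr (parcs (generalized_petersen n k)) (pverts (generalized_petersen n k) - X))\<^sup>*"
  shows "k + 1 \<le> card (X \<inter> columns n {a..<b})"
proof -
  let ?G = "generalized_petersen n k"
  let ?R = "Restr (parcs ?G) (pverts ?G - X)"
  note n = \<open>0 < n\<close>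
  have V: "Outer (m mod n) \<in> pverts ?G" "Inner (m mod n) \<in> pverts ?G" for m
    using n by (auto simp: pverts_generalized_petersen)
  have symR: "sym (?R\<^sup>*)"
    by (rule sym_rtrancl_Restr[OF sym_parcs_generalized_petersen])
  have OO: "(Outer (p mod n), Outer (q mod n)) \<in> ?R\<^sup>*"
    if "p \<le> q" "\<And>m. p \<le> m \<Longrightarrow> m \<le> q \<Longrightarrow> Outer (m mod n) \<notin> X" for p q
    using that
  proof (induction q rule: dec_induct)
    case (step q)
    have "(Outer (q mod n), Outer (Suc q mod n)) \<in> ?R"
      using step.prems[of q] step.prems[of "Suc q"] step.hyps V parcs_generalized_petersen(1)[OF n] by auto
    moreover have "(Outer (p mod n), Outer (q mod n)) \<in> ?R\<^sup>*"
      using step.IH step.prems by auto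
    ultimately show ?case by (rule rtrancl_into_rtrancl[rotated])
  qed simp
  have II: "(Inner (p mod n), Inner ((p + q * k) mod n)) \<in> ?R\<^sup>*"
    if "\<And>l. l \<le> q \<Longrightarrow> Inner ((p + l * k) mod n) \<notin> X" for p q
    using that
  proof (induction q)
    case (Suc q)
    have "(Inner ((p + q * k) mod n), Inner ((p + q * k + k) mod n)) \<in> ?R"
      using Suc.prems[of q] Suc.prems[of "Suc q"] V
        parcs_generalized_petersen(3)[OF n, of "p + q * k" k]
      by (auto simp: algebra_simps)
    moreover have "(Inner (p mod n), Inner ((p + q * k) mod n)) \<in> ?R\<^sup>*"
      using Suc by auto
    ultimately have "(Inner (p mod n), Inner ((p + q * k + k) mod n)) \<in> ?R\<^sup>*"
      by (rule rtrancl_into_rtrancl[rotated])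
    moreover have "p + Suc q * k = p + q * k + k" by simp
    ultimately show ?case by (simp only:)
  qed simp
  have OI: "(Outer (p mod n), Inner (p mod n)) \<in> ?R\<^sup>*"
    if "Outer (p mod n) \<notin> X" "Inner (p mod n) \<notin> X" for p
    using that V parcs_generalized_petersen(2)[OF n] by auto
  \<comment> \<open>The outer path from \<open>a\<close> to \<open>b\<close> must be blocked, and
    strictly before \<open>b\<close> since the window at \<open>b\<close> is free.\<close>
  have outer: "\<exists>m\<ge>a. m < b \<and> Outer (m mod n) \<in> X"
  proof (rule ccontr)
    assume "\<not> ?thesis"
    moreover have "Outer (b mod n) \<notin> X"
      using free_windowD(1)[OF wb, of b] assms by simp
    ultimately show False
      using OO[of a b] sep \<open>a \<le> b\<close> by (metis le_neq_implies_less)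
  qed
  \<comment> \<open>The path for \<open>r\<close> runs along the outer cycle to column
    \<open>a + r\<close>, down the spoke, in inner steps of \<open>k\<close> to its first column
    \<open>?e\<close> at or after \<open>b\<close>, up the spoke and back to \<open>b\<close>.
    Column \<open>?e\<close> is in the window at \<open>b\<close>, so only an inner vertex before
    \<open>b\<close> can block the path.\<close>
  have inner: "\<exists>q. a + r + q * k < b \<and> Inner ((a + r + q * k) mod n) \<in> X" if r: "r < k" for r
  proof (rule ccontr)
    assume none: "\<not> ?thesis"
    define q where "q = (LEAST q. b \<le> a + r + q * k)"
    have ex: "b \<le> a + r + b * k"
      using \<open>0 < k\<close> by (cases k) auto
    have q: "b \<le> a + r + q * k"
      unfolding q_def by (rule LeastI[of _ b]) (rule ex)
    have less: "a + r + l * k < b" if "l < q" for l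
      using not_less_Least[of l "\<lambda>q. b \<le> a + r + q * k"] that by (simp add: q_def)
    have q': "a + r + q * k < b + k"
    proof (cases q)
      case 0
      then show ?thesis using r \<open>a \<le> b\<close> by simp
    next
      case (Suc l)
      then show ?thesis using less[of l] by simp
    qed
    let ?e = "a + r + q * k"
    have "(Outer (a mod n), Outer ((a + r) mod n)) \<in> ?R\<^sup>*"
      using r free_windowD(1)[OF wa] by (intro OO) auto
    also have "(Outer ((a + r) mod n), Inner ((a + r) mod n)) \<in> ?R\<^sup>*"
      using r by (intro OI free_windowD[OF wa]) auto
    also have "(Inner ((a + r) mod n), Inner (?e mod n)) \<in> ?R\<^sup>*"
    proof (rule II)
      fix l assume "l \<le> q"
      then show "Inner ((a + r + l * k) mod n) \<notin> X"
        using none less[of l] free_windowD(2)[OF wb q q'] by (cases "l = q") auto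
    qed
    also have "(Inner (?e mod n), Outer (?e mod n)) \<in> ?R\<^sup>*"
      using OI[of ?e] free_windowD[OF wb q q'] symR by (meson symD)
    also have "(Outer (?e mod n), Outer (b mod n)) \<in> ?R\<^sup>*"
    proof -
      have "(Outer (b mod n), Outer (?e mod n)) \<in> ?R\<^sup>*"
        using q q' free_windowD(1)[OF wb] by (intro OO) auto
      then show ?thesis using symR by (meson symD)
    qed
    finally show False using sep by blast
  qed
  obtain m0 where m0: "a \<le> m0" "m0 < b" "Outer (m0 mod n) \<in> X"
    using outer by blast
  have "\<forall>r. \<exists>q. r < k \<longrightarrow> a + r + q * k < b \<and> Inner ((a + r + q * k) mod n) \<in> X"
    using inner by blast
  from choice[OF this]
  obtain q where q: "\<And>r. r < k \<Longrightarrow> a + r + q r * k < b \<and> Inner ((a + r + q r * k) mod n) \<in> X"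
    by blast
  \<comment> \<open>One blocker for each path: the value at \<open>k\<close> belongs to the outer
    path, those below \<open>k\<close> to the residue classes.\<close>
  define g where "g r = (if r = k then Outer (m0 mod n) else Inner ((a + r + q r * k) mod n))" for r
  have inj_mod: "x = y" if "a \<le> x" "x < b" "a \<le> y" "y < b" "x mod n = y mod n" for x y
  proof -
    \<comment> \<open>Natural subtraction truncates, so this only says that \<open>x\<close> is at
      most \<open>y\<close>; it is then used in both directions.\<close>
    have "x - y = 0" if "x \<in> {a..<b}" "y \<in> {a..<b}" "x mod n = y mod n" for x y
    proof (cases "y \<le> x")
      case True
      then have "n dvd x - y"
        using that(3) mod_eq_dvd_iff_nat by metis
      moreover have "x - y < n"
        using that(1,2) n \<open>b \<le> a + n\<close> unfolding atLeastLessThan_iff by linarith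
      ultimately show ?thesis
        using nat_dvd_not_less by blast
    qed simp
    from this[of x y] this[of y x] show ?thesis
      using that by simp
  qed
  have "inj_on g {..k}"
  proof (rule inj_onI)
    fix r s assume rs: "r \<in> {..k}" "s \<in> {..k}" "g r = g s"
    show "r = s"
    proof (cases "r = k \<or> s = k")
      case False
      then have *: "r < k" "s < k" using rs by auto
      then have "(a + r + q r * k) mod n = (a + s + q s * k) mod n"
        using rs(3) by (simp add: g_def)
      moreover have "a + r + q r * k < b" "a + s + q s * k < b"
        using q * by blast+
      ultimately have "a + r + q r * k = a + s + q s * k"
        using inj_mod[of "a + r + q r * k" "a + s + q s * k"] by simp
      then have "r + q r * k = s + q s * k" by simp
      then have "(r + q r * k) mod k = (s + q s * k) mod k" by simp
      then show ?thesis using * by simp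
    qed (use rs in \<open>auto simp: g_def split: if_splits\<close>)
  qed
  moreover have "g ` {..k} \<subseteq> X \<inter> columns n {a..<b}"
    using q m0 by (fastforce simp: g_def columns_def)
  ultimately show ?thesis
    using card_inj_on_le[of g "{..k}" "X \<inter> columns n {a..<b}"] \<open>finite X\<close> by simp
qed

text \<open>Separation costs \<open>k + 1\<close> vertices on each of the two disjoint arcs between
  the windows, and \<open>2 * k + 2\<close> is more than \<open>X\<close> may have.\<close>

lemma free_windows_connected:
  assumes "0 < k" "X \<subseteq> pverts (generalized_petersen n k)" "card X \<le> 2 * k + 1"
    and "i < n" "j < n" "free_window n k X i" "free_window n k X j"
  shows "(Outer i, Outer j) \<in>
      (Restr (parcs (generalized_petersen n k)) (pverts (generalized_petersen n k) - X))\<^sup>*"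
proof -
  let ?R = "Restr (parcs (generalized_petersen n k)) (pverts (generalized_petersen n k) - X)"
  have symR: "sym (?R\<^sup>*)"
    by (rule sym_rtrancl_Restr[OF sym_parcs_generalized_petersen])
  have fin: "finite X"
    using assms(2) by (rule finite_subset) (simp add: pverts_generalized_petersen)
  have *: "(Outer i, Outer j) \<in> ?R\<^sup>*"
    if ij: "i < j" "j < n" "free_window n k X i" "free_window n k X j" for i j
  proof (rule ccontr)
    assume sep: "(Outer i, Outer j) \<notin> ?R\<^sup>*"
    then have sep': "(Outer j, Outer i) \<notin> ?R\<^sup>*"
      using symR by (meson symD)
    let ?A = "columns n {i..<j}" and ?B = "columns n {j..<i + n}"
    \<comment> \<open>The second arc runs from \<open>j\<close> around to \<open>i\<close>, written
      as \<open>i + n\<close> to make it an interval.\<close>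
    have "(i + n + d) mod n = (i + d) mod n" for d
      by (metis add.assoc add.commute mod_add_self2)
    then have w: "free_window n k X (i + n)"
      using ij(3) by (simp add: free_window_def)
    have A: "k + 1 \<le> card (X \<inter> ?A)"
      using assms(1) fin ij sep by (intro card_blockers) auto
    have B: "k + 1 \<le> card (X \<inter> ?B)"
      using assms(1) fin ij sep' w by (intro card_blockers) auto
    \<comment> \<open>An index of the second arc reduces either to itself, which is at least
      \<open>j\<close>, or to a value below \<open>i\<close>.\<close>
    have "x mod n \<noteq> y mod n" if "i \<le> x" "x < j" "j \<le> y" "y < i + n" for x y
      using that ij by (cases "y < n") (auto simp: mod_if[of y])
    then have "?A \<inter> ?B = {}"
      by (auto simp: columns_def)
    then have "card (X \<inter> ?A) + card (X \<inter> ?B) = card (X \<inter> ?A \<union> X \<inter> ?B)"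
      using fin by (intro card_Un_disjoint[symmetric]) auto
    also have "\<dots> \<le> card X"
      using fin by (intro card_mono) auto
    finally show False
      using A B assms(3) by simp
  qed
  show ?thesis
    using *[of i j] *[of j i] assms symD[OF symR] by (cases i j rule: linorder_cases) auto
qed

text \<open>A vertex in column \<open>c\<close> spoils at most the \<open>k\<close> windows starting
  at \<open>c\<close>, \<open>c - 1\<close>, ..., \<open>c - k + 1\<close>, read modulo
  \<open>n\<close>.\<close>

lemma card_not_free_window_le:
  assumes "finite X"
  shows "card {i. i < n \<and> \<not> free_window n k X i} \<le> card X * k"
proof -
  define col where "col x = (case x of Outer m \<Rightarrow> m | Inner m \<Rightarrow> m)" for x
  \<comment> \<open>The subtraction may wrap around below 0 and is therefore done in the
    integers.\<close>
  let ?h = "\<lambda>(x, d). nat ((int (col x) - int d) mod int n)"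
  have "{i. i < n \<and> \<not> free_window n k X i} \<subseteq> ?h ` (X \<times> {..<k})"
  proof
    fix i assume "i \<in> {i. i < n \<and> \<not> free_window n k X i}"
    then obtain d x where *: "i < n" "d < k" "x \<in> X" "col x = (i + d) mod n"
      by (force simp: free_window_def col_def)
    then have "(int (col x) - int d) mod int n = int i"
      by (simp add: zmod_int mod_simps)
    with * show "i \<in> ?h ` (X \<times> {..<k})"
      by (force intro: image_eqI[of _ _ "(x, d)"])
  qed
  then have "card {i. i < n \<and> \<not> free_window n k X i} \<le> card (X \<times> {..<k})"
    using assms by (meson card_image_le card_mono finite_SigmaI finite_imageI finite_lessThan le_trans)
  then show ?thesis by (simp add: card_cartesian_product)
qed

lemma free_windows_intersect:
  assumes "finite X" "finite Y" "(card X + card Y) * k < n"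
  shows "\<exists>i<n. free_window n k X i \<and> free_window n k Y i"
proof (rule ccontr)
  assume "\<not> ?thesis"
  then have "{..<n} \<subseteq> {i. i < n \<and> \<not> free_window n k X i} \<union> {i. i < n \<and> \<not> free_window n k Y i}"
    by auto
  then have "card {..<n} \<le> card ({i. i < n \<and> \<not> free_window n k X i} \<union> {i. i < n \<and> \<not> free_window n k Y i})"
    by (intro card_mono) auto
  then show False
    using card_Un_le[of "{i. i < n \<and> \<not> free_window n k X i}" "{i. i < n \<and> \<not> free_window n k Y i}"]
      card_not_free_window_le[OF assms(1), of n k] card_not_free_window_le[OF assms(2), of n k] assms(3)
    by (simp add: algebra_simps)
qed

lemma generalized_petersen_width_ge:
  assumes "0 < k" "(4 * k + 2) * k < n"
    and dec: "tree_decomposition (generalized_petersen n k) T B"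
  shows "2 * k + 1 \<le> decomposition_width T B"
proof (rule ccontr)
  let ?G = "generalized_petersen n k"
  assume small: "\<not> ?thesis"
  have tree: "pair_graph T" and cover: "(\<Union>t\<in>pverts T. B t) = pverts ?G"
    using dec by (auto simp: tree_decomposition_def undirected_tree_def)
  interpret T: pair_graph T by fact
  have card: "card (B t) \<le> 2 * k + 1" if "t \<in> pverts T" for t
  proof -
    have "card (B t) \<le> Max ((\<lambda>t. card (B t)) ` pverts T)"
      using that T.finite_verts by (intro Max_ge) auto
    then show ?thesis
      using small by (simp add: decomposition_width_def)
  qed
  have sub: "B t \<subseteq> pverts ?G" if "t \<in> pverts T" for t
    using that cover by blast
  then have fin: "finite (B t)" if "t \<in> pverts T" for t
    using that by (auto simp: pverts_generalized_petersen intro: finite_subset)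
  \<comment> \<open>A free window is represented by its first outer vertex, which is outside the bag
    because \<open>0 < k\<close>.\<close>
  define S where "S t = Outer ` {i. i < n \<and> free_window n k (B t) i}" for t
  show False
  proof (rule tree_decomposition_no_haven[OF dec, of S])
    fix t assume "t \<in> pverts T"
    show "S t \<subseteq> pverts ?G - B t"
      using assms(1) by (auto simp: S_def pverts_generalized_petersen free_window_def)
  next
    fix t u v assume "t \<in> pverts T" "u \<in> S t" "v \<in> S t"
    then show "(u, v) \<in> (Restr (parcs ?G) (pverts ?G - B t))\<^sup>*"
      using free_windows_connected[OF assms(1) sub card] by (auto simp: S_def)
  next
    fix s t assume st: "s \<in> pverts T" "t \<in> pverts T"
    \<comment> \<open>This bounds the number of windows spoilt by either bag; as it is below
      \<open>n\<close>, some window is free for both.\<close>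
    have "(card (B s) + card (B t)) * k \<le> (4 * k + 2) * k"
      using card[OF st(1)] card[OF st(2)] by (intro mult_le_mono1) auto
    then show "S s \<inter> S t \<noteq> {}"
      using free_windows_intersect[OF fin[OF st(1)] fin[OF st(2)], of k n] assms(2)
      by (auto simp: S_def)
  qed
qed

section \<open>The upper bound\<close>

definition path_graph :: "nat \<Rightarrow> nat pair_pre_digraph" where
  "path_graph L = \<lparr> pverts = {..<L}, parcs = {(i, j). i < L \<and> j < L \<and> (j = Suc i \<or> i = Suc j)} \<rparr>"

lemma sym_parcs_path_graph: "sym (parcs (path_graph L))"
  by (auto simp: path_graph_def sym_def)

lemma pair_graph_path_graph: "pair_graph (path_graph L)"
proof -
  have "parcs (path_graph L) \<subseteq> {..<L} \<times> {..<L}"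
    by (auto simp: path_graph_def)
  then have "finite (parcs (path_graph L))"
    by (rule finite_subset) simp
  then show ?thesis
    by unfold_locales (auto simp: path_graph_def symmetric_def sym_def)
qed

lemma connected_path_graph_interval:
  assumes "l \<le> h" "h < L"
  shows "connected (with_proj (path_graph L) \<restriction> {l..h})"
proof -
  let ?R = "Restr (parcs (path_graph L)) {l..h}"
  have from_l: "(l, j) \<in> ?R\<^sup>*" if "l \<le> j" "j \<le> h" for j
    using that
  proof (induction j rule: dec_induct)
    case (step j)
    then have "(j, Suc j) \<in> ?R"
      using assms by (auto simp: path_graph_def)
    then show ?case
      using step by (meson Suc_leD rtrancl.rtrancl_into_rtrancl)
  qed simp
  have "(i, j) \<in> ?R\<^sup>*" if "i \<in> {l..h}" "j \<in> {l..h}" for i j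
    using from_l[of i] from_l[of j] that symD[OF sym_rtrancl_Restr[OF sym_parcs_path_graph], of l i L "{l..h}"]
    by (auto intro: rtrancl_trans)
  then show ?thesis
    unfolding connected_induce_iff[OF sym_parcs_path_graph] using assms by auto
qed

text \<open>Both neighbours of the largest vertex of a cycle would be its predecessor.\<close>

lemma path_graph_acyclic:
  assumes "length ys \<ge> 4" "hd ys = last ys" "distinct (tl ys)"
    and "successively (\<lambda>x y. (x, y) \<in> parcs (path_graph L)) ys"
  shows False
proof -
  let ?l = "length ys - 1"
  have ends: "ys ! 0 = ys ! ?l"
    using assms(1,2) by (cases "ys = []") (auto simp: hd_conv_nth last_conv_nth)
  have adj: "ys ! Suc i = Suc (ys ! i) \<or> ys ! i = Suc (ys ! Suc i)" if "i < ?l" for i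
    using assms(4) that by (auto simp: successively_conv_nth path_graph_def)
  have inj: "i = j" if "0 < i" "i \<le> ?l" "0 < j" "j \<le> ?l" "ys ! i = ys ! j" for i j
  proof -
    have "i - 1 = j - 1"
      using that assms(3) by (subst nth_eq_iff_index_eq[of "tl ys", symmetric]) (auto simp: nth_tl)
    then show ?thesis using that by linarith
  qed
  define M where "M = Max (set ys)"
  have "M \<in> set ys"
    unfolding M_def using assms(1) by (intro Max_in) auto
  then obtain i0 where "i0 < length ys" "ys ! i0 = M"
    by (meson in_set_conv_nth)
  then have i0: "i0 \<le> ?l" "ys ! i0 = M" by auto
  \<comment> \<open>The closing vertex is listed at both ends. A position in the tail has a
    predecessor, and distinctness applies to it.\<close>
  obtain i where i: "0 < i" "i \<le> ?l" "ys ! i = M"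
  proof (cases "i0 = 0")
    case True
    then show thesis using i0 ends assms(1) by (intro that[of ?l]) auto
  next
    case False
    then show thesis using i0 by (intro that[of i0]) auto
  qed
  have le: "ys ! j \<le> M" if "j \<le> ?l" for j
    unfolding M_def using that assms(1) by (intro Max_ge) auto
  have pre: "Suc (ys ! (i - 1)) = M"
  proof -
    have "i - 1 < ?l" using i by linarith
    then show ?thesis
      using adj[of "i - 1"] le[of "i - 1"] i by simp
  qed
  show False
  proof (cases "i = ?l")
    case True
    have "0 < ?l" "1 \<le> ?l" using assms(1) by auto
    then have "Suc (ys ! 1) = M"
      using adj[of 0] le[of 1] ends i True by simp
    with pre have "ys ! 1 = ys ! (i - 1)" by linarith
    moreover have "0 < i - 1" "i - 1 \<le> ?l"
      using True assms(1) by linarith+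
    ultimately have "1 = i - 1"
      using \<open>1 \<le> ?l\<close> inj[OF zero_less_one] by blast
    then show False
      using True assms(1) by linarith
  next
    case False
    then have "i < ?l" "Suc i \<le> ?l" using i by auto
    then have suc: "Suc (ys ! Suc i) = M"
      using adj[of i] le[of "Suc i"] i by simp
    show False
    proof (cases "i = 1")
      case True
      then have "ys ! Suc i = ys ! ?l"
        using pre suc ends by simp
      then have "Suc i = ?l"
        using \<open>Suc i \<le> ?l\<close> inj[of "Suc i" ?l] by simp
      then show False
        using True assms(1) by linarith
    next
      case False
      then have "0 < i - 1" "i - 1 \<le> ?l"
        using i by linarith+
      moreover have "ys ! Suc i = ys ! (i - 1)"
        using pre suc by linarith
      ultimately have "Suc i = i - 1"
        using \<open>Suc i \<le> ?l\<close> inj[OF zero_less_Suc] by blast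
      then show False by simp
    qed
  qed
qed

lemma undirected_tree_path_graph:
  assumes "0 < L"
  shows "undirected_tree (path_graph L)"
proof -
  have "with_proj (path_graph L) \<restriction> {0..L - 1} = with_proj (path_graph L)"
    using assms by (auto simp: induce_subgraph_def with_proj_def path_graph_def)
  then have "connected (with_proj (path_graph L))"
    using connected_path_graph_interval[of 0 "L - 1" L] assms by auto
  then show ?thesis
    using ex_cycle_iff[OF pair_graph_path_graph] path_graph_acyclic
    unfolding undirected_tree_def by (blast intro: pair_graph_path_graph)
qed

lemma undirected_path_path_graph:
  assumes "0 < L"
  shows "undirected_path (path_graph L)"
proof -
  have "{([0..<L] ! i, [0..<L] ! Suc i) | i. Suc i < length [0..<L]} = {(i, Suc i) | i. Suc i < L}"
    "{([0..<L] ! Suc i, [0..<L] ! i) | i. Suc i < length [0..<L]} = {(Suc i, i) | i. Suc i < L}"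
    by (intro Collect_cong ex_cong1; auto)+
  moreover have "parcs (path_graph L) = {(i, Suc i) | i. Suc i < L} \<union> {(Suc i, i) | i. Suc i < L}"
    by (auto simp: path_graph_def)
  moreover have "pverts (path_graph L) = set [0..<L]" "[0..<L] \<noteq> []" "distinct [0..<L]"
    using assms by (auto simp: path_graph_def)
  ultimately show ?thesis
    unfolding undirected_path_def by (intro exI[of _ "[0..<L]"] conjI) (simp_all only: not_False_eq_True)
qed

text \<open>The nodes of \<open>v\<close> form the interval from \<open>lo v\<close> to
  \<open>hi v\<close>, hence a subpath, and overlapping intervals share the larger of their left
  ends. The upper bound is thus reduced to a choice of intervals.\<close>

lemma path_decomposition_intervals:
  assumes G: "pair_graph G" and "0 < L"
    and lh: "\<And>v. v \<in> pverts G \<Longrightarrow> lo v \<le> hi v \<and> hi v < L"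
    and edges: "\<And>x y. (x, y) \<in> parcs G \<Longrightarrow> lo x \<le> hi y \<and> lo y \<le> hi x"
  shows "path_decomposition G (path_graph L) (\<lambda>t. {v \<in> pverts G. lo v \<le> t \<and> t \<le> hi v})"
proof -
  interpret G: pair_graph G by fact
  let ?B = "\<lambda>t. {v \<in> pverts G. lo v \<le> t \<and> t \<le> hi v}"
  have V: "pverts (path_graph L) = {..<L}"
    by (simp add: path_graph_def)
  have "\<exists>t\<in>pverts (path_graph L). x \<in> ?B t \<and> y \<in> ?B t" if "(x, y) \<in> parcs G" for x y
  proof -
    have "x \<in> pverts G" "y \<in> pverts G"
      using G.in_arcsD1[OF that] G.in_arcsD2[OF that] by auto
    then show ?thesis
      unfolding V using lh[of x] lh[of y] edges[OF that]
      by (intro bexI[of _ "max (lo x) (lo y)"]) auto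
  qed
  moreover have "connected (with_proj (path_graph L) \<restriction> {t \<in> pverts (path_graph L). v \<in> ?B t})"
    if "v \<in> pverts G" for v
  proof -
    have "{t \<in> pverts (path_graph L). v \<in> ?B t} = {lo v..hi v}"
      using lh[OF that] that by (auto simp: V)
    then show ?thesis
      using connected_path_graph_interval lh[OF that] by simp
  qed
  moreover have "(\<Union>t\<in>pverts (path_graph L). ?B t) = pverts G"
    using lh by (auto simp: V intro: le_less_trans)
  ultimately show ?thesis
    using undirected_tree_path_graph[OF \<open>0 < L\<close>] undirected_path_path_graph[OF \<open>0 < L\<close>]
    unfolding path_decomposition_def tree_decomposition_def by blast
qed

text \<open>
  A window sliding along the columns holds the inner vertices in \<open>k\<close> or \<open>k + 1\<close> consecutive
  columns and two or one outer vertices; the \<open>k + 1\<close> vertices that absorb the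
  edges with wraparound stay in all bags.
\<close>

lemma generalized_petersen_path_decomposition:
  assumes "0 < k" "2 * k < n"
  shows "\<exists>(T :: nat pair_pre_digraph) B. path_decomposition (generalized_petersen n k) T B \<and>
    decomposition_width T B \<le> 2 * k + 2"
proof -
  let ?G = "generalized_petersen n k"
  \<comment> \<open>Each column takes two time steps. \<open>Inner m\<close> enters at
    \<open>2 * m\<close> and stays until \<open>Inner (m + k)\<close> enters; \<open>Outer m\<close>
    enters at \<open>2 * m + 1\<close> and stays until \<open>Outer (m + 1)\<close> enters.
    \<open>Outer 0\<close> and the first \<open>k\<close> inner vertices are always present and meet
    the wraparound edges; \<open>2 * n - 1\<close> is the last node.\<close>
  define lo where "lo v = (case v of
    Outer m \<Rightarrow> if m = 0 then 0 else 2 * m + 1 | Inner m \<Rightarrow> if m < k then 0 else 2 * m)" for v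
  define hi where "hi v = (case v of
    Outer m \<Rightarrow> if m = 0 then 2 * n - 1 else min (2 * m + 3) (2 * n - 1)
  | Inner m \<Rightarrow> if m < k then 2 * n - 1 else min (2 * m + 2 * k) (2 * n - 1))" for v
  let ?B = "\<lambda>t. {v \<in> pverts ?G. lo v \<le> t \<and> t \<le> hi v}"
  have outer: "lo (Outer i) \<le> hi (Outer ((i + 1) mod n)) \<and> lo (Outer ((i + 1) mod n)) \<le> hi (Outer i)"
    if "i < n" for i
    using that by (cases "i + 1 < n") (auto simp: lo_def hi_def mod_if)
  have inner: "lo (Inner i) \<le> hi (Inner ((i + k) mod n)) \<and> lo (Inner ((i + k) mod n)) \<le> hi (Inner i)"
    if "i < n" for i
    using that assms by (cases "i + k < n") (auto simp: lo_def hi_def mod_if)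
  have spoke: "lo (Outer i) \<le> hi (Inner i) \<and> lo (Inner i) \<le> hi (Outer i)" if "i < n" for i
    using that assms by (auto simp: lo_def hi_def)
  have dec: "path_decomposition ?G (path_graph (2 * n)) ?B"
  proof (rule path_decomposition_intervals)
    show "pair_graph ?G"
      using assms by (rule pair_graph_generalized_petersen)
    show "lo v \<le> hi v \<and> hi v < 2 * n" if "v \<in> pverts ?G" for v
      using that assms by (auto simp: pverts_generalized_petersen lo_def hi_def)
    show "lo x \<le> hi y \<and> lo y \<le> hi x" if "(x, y) \<in> parcs ?G" for x y
      using that outer inner spoke by (auto simp: generalized_petersen_def Let_def)
  qed (use assms in auto)
  have bag: "card (?B t) \<le> 2 * k + 3" for t
  proof -
    define I where "I = {m. 2 * m \<le> t \<and> t \<le> 2 * m + 2 * k}"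
    define J where "J = {m. 2 * m + 1 \<le> t \<and> t \<le> 2 * m + 3}"
    \<comment> \<open>At an even time there are at most \<open>k + 1\<close> inner columns and one
      outer column. At an odd time the oldest inner one has left and a new outer one has entered, so
      the sum stays at most \<open>k + 2\<close>. At time 0 the set \<open>J\<close> is empty while
      \<open>s - 1\<close> truncates to 0, hence the inclusion.\<close>
    have I_J: "card I + card J \<le> k + 2 \<and> finite I \<and> finite J"
    proof (cases "even t")
      case True
      then obtain s where "t = 2 * s" by blast
      then have "I = {s - k..s}" "J \<subseteq> {s - 1}"
        by (auto simp: I_def J_def)
      moreover from this have "card J \<le> 1"
        using card_mono[of "{s - 1}" J] by simp
      ultimately show ?thesis
        using finite_subset by auto
    next
      case False
      then obtain s where "t = 2 * s + 1" by (blast elim: oddE)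
      then have "I = {Suc s - k..s}" "J \<subseteq> {s - 1, s}"
        by (auto simp: I_def J_def)
      moreover from this have "card J \<le> 2"
        using card_mono[of "{s - 1, s}" J] card_insert_le_m1[of 2 "{s}" "s - 1"] by simp
      ultimately show ?thesis
        using finite_subset by auto
    qed
    have "?B t \<subseteq> (Inner ` {..<k} \<union> {Outer 0}) \<union> (Inner ` I \<union> Outer ` J)"
    proof
      fix v assume "v \<in> ?B t"
      then show "v \<in> (Inner ` {..<k} \<union> {Outer 0}) \<union> (Inner ` I \<union> Outer ` J)"
        by (cases v) (auto simp: lo_def hi_def I_def J_def split: if_splits)
    qed
    then have "card (?B t) \<le> card ((Inner ` {..<k} \<union> {Outer 0}) \<union> (Inner ` I \<union> Outer ` J))"
      using I_J by (intro card_mono) auto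
    also have "\<dots> \<le> (card (Inner ` {..<k}) + card {Outer 0}) + (card (Inner ` I) + card (Outer ` J))"
      by (intro order_trans[OF card_Un_le] add_mono card_Un_le)
    also have "\<dots> \<le> (k + 1) + (card I + card J)"
      using I_J card_image_le[of "{..<k}" Inner] card_image_le[of I Inner] card_image_le[of J Outer]
      by simp
    finally show ?thesis using I_J by simp
  qed
  have "Max ((\<lambda>t. card (?B t)) ` pverts (path_graph (2 * n))) \<le> 2 * k + 3"
    using bag assms by (intro Max.boundedI) (auto simp: path_graph_def lessThan_empty_iff)
  then have "decomposition_width (path_graph (2 * n)) ?B \<le> 2 * k + 2"
    by (simp add: decomposition_width_def)
  with dec show ?thesis by blast
qed

section \<open>Treewidth and pathwidth as attained minima\<close>

lemma treewidth_attained: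
  assumes "pair_graph G"
  obtains T :: "nat pair_pre_digraph" and B
  where "tree_decomposition G T B" "decomposition_width T B = treewidth G"
proof -
  have "\<exists>w (T :: nat pair_pre_digraph) B. tree_decomposition G T B \<and> decomposition_width T B = w"
    using path_decomposition_trivial[OF assms] unfolding path_decomposition_def by blast
  then show thesis
    using LeastI_ex[of "\<lambda>w. \<exists>(T :: nat pair_pre_digraph) B.
      tree_decomposition G T B \<and> decomposition_width T B = w"] that
    unfolding treewidth_def by blast
qed

lemma treewidth_le_pathwidth:
  assumes "pair_graph G"
  shows "treewidth G \<le> pathwidth G"
proof -
  have "\<exists>w (T :: nat pair_pre_digraph) B. path_decomposition G T B \<and> decomposition_width T B = w"
    using path_decomposition_trivial[OF assms] by blast
  from LeastI_ex[OF this] show ?thesis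
    unfolding treewidth_def pathwidth_def path_decomposition_def
    by (intro Least_le) blast
qed

theorem theorem1p5:
  fixes n k :: nat
  assumes "0 < n" and "0 < k" and "n \<ge> 8 * (2 * k + 2)\<^sup>2"
  shows "2 * k + 1 \<le> treewidth (generalized_petersen n k) \<and>
         treewidth (generalized_petersen n k) \<le> pathwidth (generalized_petersen n k) \<and>
         pathwidth (generalized_petersen n k) \<le> 2 * k + 2"
proof (intro conjI)
  let ?G = "generalized_petersen n k"
  have large: "(4 * k + 2) * k < n"
    using assms(3) by (auto simp: power2_eq_square algebra_simps)
  have "2 * k \<le> (4 * k + 2) * k" by simp
  with large have kn: "2 * k < n" by linarith
  have G: "pair_graph ?G"
    using assms(2) kn by (rule pair_graph_generalized_petersen)
  obtain T :: "nat pair_pre_digraph" and B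
    where "tree_decomposition ?G T B" "decomposition_width T B = treewidth ?G"
    using treewidth_attained[OF G] by blast
  then show "2 * k + 1 \<le> treewidth ?G"
    using generalized_petersen_width_ge[OF assms(2) large] by metis
  show "treewidth ?G \<le> pathwidth ?G"
    using G by (rule treewidth_le_pathwidth)
  obtain T :: "nat pair_pre_digraph" and B
    where "path_decomposition ?G T B" "decomposition_width T B \<le> 2 * k + 2"
    using generalized_petersen_path_decomposition[OF assms(2) kn] by blast
  then have "pathwidth ?G \<le> decomposition_width T B"
    unfolding pathwidth_def by (intro Least_le) blast
  then show "pathwidth ?G \<le> 2 * k + 2"
    using \<open>decomposition_width T B \<le> 2 * k + 2\<close> by linarith
qed

end
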